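(* For every integer $h\geq 0$, there exists a series-parallel graph $G_h$, in fact a tree-apex graph, that has track-number at most $4$ and layered pathwidth $\Theta(h)$ (where the asymptotic notation refers to the family $(G_h)$ as $h\to\infty$).
   Context: Graphs are finite, simple and undirected. A tree-apex graph is a graph that can be obtained from a tree by adding a universal vertex that is adjacent to all other vertices. A $k$-track layout of a graph is a partition of its vertex set into $k$ sequences, called tracks, such that the vertices in each track form an independent set and the edges between each pair of tracks form a non-crossing set; that is, there are no edges $uv$ and $u'v'$ such that $u$ is before $u'$ in one track but $v$ is after $v'$ in another track. The track-number of a graph is the minimum number of tracks in a track layout of it. A path decomposition of a graph is a sequence of vertex subsets (bags) such that each vertex belongs to a nonempty contiguous subsequence of bags and every two adjacent vertices have at least one bag in common. A layering of a graph is a partition of its vertices into a sequence of disjoint subsets (layers) such that each edge joins vertices in the same layer or in consecutive layers. The layered pathwidth of a graph $G$ is the minimum integer $k$ such that for some path decomposition and some layering of $G$, the intersection of each bag with each layer has at most $k$ vertices. *)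

theory Defs
  imports "Graph_Theory.Digraph_Component" "HOL-Library.Landau_Symbols"
begin

text \<open>
  A finite simple undirected graph is a \<open>pair_graph\<close>: each edge \<open>uv\<close> is represented by the two
  arcs \<open>(u,v)\<close> and \<open>(v,u)\<close>.
\<close>

subsection \<open>Trees, tree-apex graphs and series-parallel graphs\<close>

text \<open>
  The library predicates \<open>forest\<close> and \<open>tree\<close> count the closed walk \<open>u, v, u\<close> along a single
  undirected edge as a cycle, so they are not usable for symmetric digraphs. In a \<open>pair_graph\<close>,
  undirected cycles are the cycles of length at least 3.
\<close>

definition undirected_tree :: "'a pair_pre_digraph \<Rightarrow> bool" where
  "undirected_tree T \<longleftrightarrow> pair_graph T \<and> Digraph_Component.connected (with_proj T) \<and>
     (\<nexists>p. pre_digraph.cycle (with_proj T) p \<and> 3 \<le> length p)"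

definition add_universal_vertex :: "'a \<Rightarrow> 'a pair_pre_digraph \<Rightarrow> 'a pair_pre_digraph" where
  "add_universal_vertex a G =
     \<lparr> pverts = insert a (pverts G),
       parcs = parcs G \<union> {a} \<times> pverts G \<union> pverts G \<times> {a} \<rparr>"

definition tree_apex_graph :: "'a pair_pre_digraph \<Rightarrow> bool" where
  "tree_apex_graph G \<longleftrightarrow>
     (\<exists>T a. undirected_tree T \<and> a \<notin> pverts T \<and> G = add_universal_vertex a T)"

definition pair_union :: "'a pair_pre_digraph \<Rightarrow> 'a pair_pre_digraph \<Rightarrow> 'a pair_pre_digraph" where
  "pair_union G H = \<lparr> pverts = pverts G \<union> pverts H, parcs = parcs G \<union> parcs H \<rparr>"

text \<open>
  Two-terminal series-parallel graphs with terminals \<open>s\<close> and \<open>t\<close>. Terminals are glued by sharing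
  vertex names, so the two parts overlap in exactly the glued terminals. Compositions never delete
  edges, hence every part of a simple graph is simple, and parallel composition only has to
  exclude the creation of a double edge.
\<close>

inductive two_terminal_sp :: "'a pair_pre_digraph \<Rightarrow> 'a \<Rightarrow> 'a \<Rightarrow> bool" where
  edge: "s \<noteq> t \<Longrightarrow> two_terminal_sp \<lparr> pverts = {s, t}, parcs = {(s, t), (t, s)} \<rparr> s t"
| series: "two_terminal_sp (pair_union G H) s t"
    if "two_terminal_sp G s m" "two_terminal_sp H m t" "pverts G \<inter> pverts H = {m}"
| parallel: "two_terminal_sp (pair_union G H) s t"
    if "two_terminal_sp G s t" "two_terminal_sp H s t"
       "pverts G \<inter> pverts H = {s, t}" "parcs G \<inter> parcs H = {}"

definition series_parallel :: "'a pair_pre_digraph \<Rightarrow> bool" where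
  "series_parallel G \<longleftrightarrow> (\<exists>s t. two_terminal_sp G s t)"

subsection \<open>Track layouts\<close>

definition precedes :: "'a list \<Rightarrow> 'a \<Rightarrow> 'a \<Rightarrow> bool" where
  "precedes xs u v \<longleftrightarrow> (\<exists>i j. i < j \<and> j < length xs \<and> xs ! i = u \<and> xs ! j = v)"

text \<open>
  Tracks may be empty; deleting an empty track leaves a track layout, so the minimum number of
  tracks does not depend on this.
\<close>

definition track_layout :: "'a pair_pre_digraph \<Rightarrow> 'a list list \<Rightarrow> bool" where
  "track_layout G ts \<longleftrightarrow>
     distinct (concat ts) \<and> set (concat ts) = pverts G \<and>
     (\<forall>t\<in>set ts. \<forall>u\<in>set t. \<forall>v\<in>set t. (u, v) \<notin> parcs G) \<and>
     (\<forall>i<length ts. \<forall>j<length ts. i \<noteq> j \<longrightarrow>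
        \<not> (\<exists>u v u' v'. (u, v) \<in> parcs G \<and> (u', v') \<in> parcs G \<and>
              precedes (ts ! i) u u' \<and> precedes (ts ! j) v' v))"

definition track_number :: "'a pair_pre_digraph \<Rightarrow> nat" where
  "track_number G = (LEAST k. \<exists>ts. length ts = k \<and> track_layout G ts)"

subsection \<open>Layered pathwidth\<close>

definition path_decomposition :: "'a pair_pre_digraph \<Rightarrow> 'a set list \<Rightarrow> bool" where
  "path_decomposition G Bs \<longleftrightarrow>
     (\<forall>B\<in>set Bs. B \<subseteq> pverts G) \<and>
     (\<forall>v\<in>pverts G. \<exists>i j. i \<le> j \<and> {k. k < length Bs \<and> v \<in> Bs ! k} = {i..j}) \<and>
     (\<forall>(u, v)\<in>parcs G. \<exists>B\<in>set Bs. u \<in> B \<and> v \<in> B)"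

text \<open>
  Layers may be empty; deleting an empty layer leaves a layering, so the minimum in
  \<open>layered_pathwidth\<close> does not depend on this.
\<close>

definition layering :: "'a pair_pre_digraph \<Rightarrow> 'a set list \<Rightarrow> bool" where
  "layering G Ls \<longleftrightarrow>
     \<Union> (set Ls) = pverts G \<and>
     (\<forall>i<length Ls. \<forall>j<length Ls. i \<noteq> j \<longrightarrow> Ls ! i \<inter> Ls ! j = {}) \<and>
     (\<forall>i<length Ls. \<forall>j<length Ls. \<forall>u\<in>Ls ! i. \<forall>v\<in>Ls ! j.
        (u, v) \<in> parcs G \<longrightarrow> i \<le> Suc j \<and> j \<le> Suc i)"

definition layered_width_le :: "'a set list \<Rightarrow> 'a set list \<Rightarrow> nat \<Rightarrow> bool" where
  "layered_width_le Bs Ls k \<longleftrightarrow> (\<forall>B\<in>set Bs. \<forall>L\<in>set Ls. card (B \<inter> L) \<le> k)"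

definition layered_pathwidth :: "'a pair_pre_digraph \<Rightarrow> nat" where
  "layered_pathwidth G =
     (LEAST k. \<exists>Bs Ls. path_decomposition G Bs \<and> layering G Ls \<and> layered_width_le Bs Ls k)"

subsection \<open>The minima exist\<close>

lemma ex_track_layout:
  assumes "pair_graph G"
  shows "\<exists>ts. track_layout G ts"
proof -
  interpret pair_graph G by fact
  obtain vs where vs: "set vs = pverts G" "distinct vs"
    using finite_distinct_list[OF pair_finite_verts] by blast
  have "concat (map (\<lambda>v. [v]) vs) = vs"
    by (induction vs) auto
  then have "track_layout G (map (\<lambda>v. [v]) vs)"
    using vs pair_no_loops by (fastforce simp: track_layout_def precedes_def)
  then show ?thesis ..
qed

lemma ex_layered_path_decomposition:
  assumes "pair_graph G"
  shows "\<exists>k Bs Ls. path_decomposition G Bs \<and> layering G Ls \<and> layered_width_le Bs Ls k"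
proof -
  interpret pair_graph G by fact
  have "\<exists>i j. i \<le> j \<and> {k. k < length [pverts G] \<and> v \<in> [pverts G] ! k} = {i..j}"
    if "v \<in> pverts G" for v
    using that by (intro exI[of _ 0]) auto
  then have "path_decomposition G [pverts G]"
    unfolding path_decomposition_def using in_arcsD1 in_arcsD2 by force
  moreover have "layering G [pverts G]"
    by (auto simp: layering_def)
  moreover have "layered_width_le [pverts G] [pverts G] (card (pverts G))"
    by (auto simp: layered_width_le_def)
  ultimately show ?thesis by blast
qed

end

theory Submission
  imports Defs
begin

text \<open>
  The graph \<open>G\<^sub>h\<close> is the complete ternary tree of height \<open>h\<close> together with an apex. Number the
  vertices of the infinite ternary tree by breadth-first search, so that the children of \<open>v\<close> are
  \<open>3v - 1\<close>, \<open>3v\<close> and \<open>3v + 1\<close>, and let \<open>0\<close> be the apex. Two properties of the parent function do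
  most of the work: it decreases every positive number, and it is monotone.

  \<^item> Series-parallel: the apex together with the subtree below \<open>v\<close> is a two-terminal graph with
    terminals \<open>v\<close> and the apex. It is the parallel composition of the edge between the terminals and,
    for each child \<open>c\<close>, of the series composition of the edge \<open>vc\<close> with the graph of \<open>c\<close>
    (\<open>two_terminal_sp_fan\<close>).

  \<^item> Four tracks: the apex is alone on one track, and a tree vertex goes to the track given by its
    depth modulo 3, each track being ordered by number. Between two tracks all edges then go from
    parent to child in the same direction, and a crossing would contradict the monotonicity of the
    parent function (\<open>track_layout_fan\<close>).

  \<^item> Lower bound: the neighbours of a vertex lie in at most three layers, so a universal vertex forces
    every bag to have at most three times the layered width (\<open>card_bag_le_universal_vertex\<close>). In any
    path decomposition, some bag contains at least \<open>h + 1\<close> vertices of a complete ternary tree of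
    height \<open>h\<close> (\<open>ex_large_bag\<close>). For the induction step take a large bag for each of the three
    subtrees below the root; the middle one of the three bags must also meet the connected subgraph
    consisting of the root and the other two subtrees, and gains a vertex.

  \<^item> Upper bound: the bags are the paths from the leaves to the root, with the apex added, ordered by
    the number of the leaf. By monotonicity the leaves below a given vertex are consecutive
    (\<open>path_decomposition_fan\<close>). With a single layer this gives width at most \<open>h + 2\<close>.
\<close>

section \<open>Trees given by a parent function\<close>

text \<open>
  Vertices are numbers and \<open>0\<close> is reserved for the apex. It is a fixed point of \<open>parent\<close>, so that
  iterating \<open>parent\<close> from any vertex ends at \<open>0\<close> and stays there.
\<close>

locale rooted_forest =
  fixes parent :: "nat \<Rightarrow> nat"
  assumes parent_less: "0 < v \<Longrightarrow> parent v < v"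
    and parent_zero: "parent 0 = 0"
begin

definition tree_on :: "nat set \<Rightarrow> nat pair_pre_digraph" where
  "tree_on S = \<lparr> pverts = S, parcs = {(u, v). u \<in> S \<and> v \<in> S \<and> (parent u = v \<or> parent v = u)} \<rparr>"

text \<open>
  A set with this property spans a connected subtree: iterating \<open>parent\<close> within the set must reach
  \<open>r\<close>, because the numbers decrease and \<open>0\<close> is excluded.
\<close>

definition rooted :: "nat set \<Rightarrow> nat \<Rightarrow> bool" where
  "rooted S r \<longleftrightarrow> r \<in> S \<and> 0 \<notin> S \<and> (\<forall>u\<in>S - {r}. parent u \<in> S)"

definition children :: "nat \<Rightarrow> nat set" where
  "children v = {u. 0 < u \<and> parent u = v}"

definition descendants :: "nat \<Rightarrow> nat \<Rightarrow> nat set" where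
  "descendants n v = {u. \<exists>k\<le>n. (parent ^^ k) u = v}"

lemma ancestor_le: "(parent ^^ k) u \<le> u"
proof (induction k)
  case (Suc k)
  then show ?case
    using parent_less[of "(parent ^^ k) u"] parent_zero
    by (cases "(parent ^^ k) u = 0") auto
qed simp

lemma ancestor_less: "(parent ^^ k) u < u" if "0 < k" "0 < u"
  using that ancestor_le[of "k - 1" "parent u"] parent_less[of u]
  by (cases k) (auto simp: funpow_Suc_right simp del: funpow.simps)

lemma ancestor_split: "i \<le> j \<Longrightarrow> (parent ^^ j) u = (parent ^^ (j - i)) ((parent ^^ i) u)"
  by (metis comp_apply funpow_add le_add_diff_inverse2)

lemma ancestor_distance_unique:
  assumes "(parent ^^ a) u = v" "(parent ^^ b) u = v" "0 < v"
  shows "a = b"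
proof -
  have *: False if "(parent ^^ a) u = v" "(parent ^^ b) u = v" "a < b" for a b
  proof -
    have "(parent ^^ b) u = (parent ^^ (b - a)) ((parent ^^ a) u)"
      using that ancestor_split[of a b u] by simp
    then show False
      using that ancestor_less[of "b - a" v] \<open>0 < v\<close> by simp
  qed
  show ?thesis
    using *[of a b] *[of b a] assms by (meson linorder_neqE_nat)
qed

lemma children_greater: "c \<in> children v \<Longrightarrow> v < c"
  using parent_less by (auto simp: children_def)

lemma descendants_ge: "u \<in> descendants n v \<Longrightarrow> v \<le> u"
  using ancestor_le by (auto simp: descendants_def)

lemma rooted_descendants:
  assumes "0 < v"
  shows "rooted (descendants n v) v"
proof -
  have "parent u \<in> descendants n v" if "u \<in> descendants n v" "u \<noteq> v" for u
  proof -
    obtain k where k: "k \<le> n" "(parent ^^ k) u = v"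
      using \<open>u \<in> descendants n v\<close> by (auto simp: descendants_def)
    with \<open>u \<noteq> v\<close> obtain k' where "k = Suc k'"
      by (cases k) auto
    with k show ?thesis
      by (auto simp: descendants_def funpow_swap1 intro!: exI[of _ k'])
  qed
  moreover have "v \<in> descendants n v"
    by (auto simp: descendants_def intro: exI[of _ 0])
  ultimately show ?thesis
    using assms by (auto simp: rooted_def dest: descendants_ge)
qed

lemma descendants_zero: "descendants 0 v = {v}"
  by (auto simp: descendants_def)

lemma descendants_Suc:
  assumes "0 < v"
  shows "descendants (Suc n) v = insert v (\<Union>c\<in>children v. descendants n c)"
proof (intro equalityI subsetI)
  fix u assume "u \<in> descendants (Suc n) v"
  then obtain k where k: "k \<le> Suc n" "(parent ^^ k) u = v"
    by (auto simp: descendants_def)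
  show "u \<in> insert v (\<Union>c\<in>children v. descendants n c)"
  proof (cases k)
    case (Suc k')
    then have "(parent ^^ k') u \<in> children v"
      using k assms parent_zero by (cases "(parent ^^ k') u = 0") (auto simp: children_def)
    moreover have "u \<in> descendants n ((parent ^^ k') u)"
      using k Suc by (auto simp: descendants_def)
    ultimately show ?thesis by blast
  qed (use k in simp)
next
  fix u assume "u \<in> insert v (\<Union>c\<in>children v. descendants n c)"
  then consider "u = v" | k where "k \<le> n" "parent ((parent ^^ k) u) = v"
    by (auto simp: children_def descendants_def)
  then show "u \<in> descendants (Suc n) v"
  proof cases
    case 1
    then show ?thesis by (auto simp: descendants_def intro: exI[of _ 0])
  next
    case (2 k)
    then show ?thesis by (auto simp: descendants_def intro!: exI[of _ "Suc k"])
  qed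
qed

text \<open>
  If subtrees of two siblings shared a vertex, one sibling would be a proper ancestor of the other,
  hence at most their common parent, which is smaller than both.
\<close>

lemma descendants_children_disjoint:
  assumes "c \<in> children v" "d \<in> children v" "c \<noteq> d"
  shows "descendants n c \<inter> descendants n d = {}"
proof -
  have *: False if "c \<in> children v" "d \<in> children v" "c \<noteq> d"
    "(parent ^^ i) u = c" "(parent ^^ j) u = d" "i \<le> j" for c d i u j
  proof -
    have "(parent ^^ j) u = (parent ^^ (j - i)) ((parent ^^ i) u)"
      using that ancestor_split[of i j u] by simp
    then have d: "(parent ^^ (j - i)) c = d"
      using that by simp
    with \<open>c \<noteq> d\<close> obtain m where "j - i = Suc m"
      by (cases "j - i") auto
    with d have "(parent ^^ m) v = d"
      using \<open>c \<in> children v\<close> by (simp add: children_def funpow_swap1)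
    then show False
      using ancestor_le[of m v] children_greater[OF \<open>d \<in> children v\<close>] by simp
  qed
  show ?thesis
  proof (rule ccontr)
    assume "\<not> ?thesis"
    then obtain u i j where "(parent ^^ i) u = c" "(parent ^^ j) u = d"
      by (auto simp: descendants_def)
    then show False
      using *[of c d i u j] *[of d c j u i] assms by (cases "i \<le> j") auto
  qed
qed

lemma finite_descendants:
  assumes "\<And>v. 0 < v \<Longrightarrow> finite (children v)" "0 < v"
  shows "finite (descendants n v)"
  using \<open>0 < v\<close>
proof (induction n arbitrary: v)
  case 0
  then show ?case by (simp add: descendants_zero)
next
  case (Suc n)
  have "finite (descendants n c)" if "c \<in> children v" for c
    using that by (intro Suc.IH) (simp add: children_def)
  then show ?case
    using assms(1) Suc.prems by (simp add: descendants_Suc)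
qed

section \<open>Trees and tree-apex graphs\<close>

lemma pair_graph_tree_on:
  assumes "finite S" "0 \<notin> S"
  shows "pair_graph (tree_on S)"
proof
  have "parcs (tree_on S) \<subseteq> S \<times> S"
    by (auto simp: tree_on_def)
  then show "finite (parcs (tree_on S))"
    by (rule finite_subset) (use assms in simp)
  have "parent u \<noteq> u" if "u \<in> S" for u
    using that \<open>0 \<notin> S\<close> parent_less[of u] by (cases "u = 0") auto
  then show "fst e \<noteq> snd e" if "e \<in> parcs (tree_on S)" for e
    using that by (cases e) (force simp: tree_on_def)
qed (use assms in \<open>auto simp: tree_on_def symmetric_def sym_def\<close>)

lemma connected_tree_on:
  assumes "finite S" "rooted S r"
  shows "Digraph_Component.connected (with_proj (tree_on S))"
proof -
  interpret T: pair_graph "tree_on S"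
    using assms by (auto simp: rooted_def intro: pair_graph_tree_on)
  have root: "u \<rightarrow>\<^sup>*\<^bsub>with_proj (tree_on S)\<^esub> r" if "u \<in> S" for u
    using that
  proof (induction u rule: less_induct)
    case (less u)
    show ?case
    proof (cases "u = r")
      case True
      then show ?thesis using less.prems T.reachable_refl[of u] by (simp add: tree_on_def)
    next
      case False
      then have p: "parent u \<in> S" "parent u < u"
        using less.prems assms parent_less[of u] by (cases "u = 0"; auto simp: rooted_def)+
      then have "(u, parent u) \<in> parcs (tree_on S)"
        using less.prems by (simp add: tree_on_def)
      then show ?thesis
        by (rule T.adj_reachable_trans) (rule less.IH[OF p(2,1)])
    qed
  qed
  have "u \<rightarrow>\<^sup>*\<^bsub>with_proj (tree_on S)\<^esub> v" if "u \<in> S" "v \<in> S" for u v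
    using root[OF \<open>u \<in> S\<close>] T.symmetric_reachable'[OF root[OF \<open>v \<in> S\<close>]] by (rule T.reachable_trans)
  then have "u \<rightarrow>\<^sup>*\<^bsub>with_proj (mk_symmetric (with_proj (tree_on S)))\<^esub> v" if "u \<in> S" "v \<in> S" for u v
    using that by (intro T.reachable_mk_symmetricI)
  then show ?thesis
    using assms by (auto simp: Digraph_Component.connected_def strongly_connected_def
        mk_symmetric_def tree_on_def rooted_def)
qed

end

lemma pair_graph_add_universal_vertex:
  assumes "pair_graph G" "a \<notin> pverts G"
  shows "pair_graph (add_universal_vertex a G)"
proof -
  interpret pair_graph G by fact
  let ?H = "add_universal_vertex a G"
  have H: "pverts ?H = insert a (pverts G)"
    "parcs ?H = parcs G \<union> {a} \<times> pverts G \<union> pverts G \<times> {a}"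
    by (simp_all add: add_universal_vertex_def)
  show ?thesis
  proof
    show "fst e \<in> pverts ?H" "snd e \<in> pverts ?H" if "e \<in> parcs ?H" for e
      using that arc_fst_in_verts arc_snd_in_verts unfolding H by auto
    show "finite (pverts ?H)" "finite (parcs ?H)"
      using pair_finite_verts pair_finite_arcs unfolding H by simp_all
    show "fst e \<noteq> snd e" if "e \<in> parcs ?H" for e
      using that pair_no_loops[of e] assms(2) unfolding H by auto
    have "sym (parcs ?H)"
      using arcs_symmetric unfolding H by (auto simp: sym_def)
    then show "symmetric (with_proj ?H)"
      by (simp add: symmetric_def)
  qed
qed

text \<open>
  The next lemmas describe a closed walk as a cyclic sequence of arcs, so that every vertex on it has
  a predecessor and a successor irrespective of where the walk starts.
\<close>

lemma tl_pawalk_verts: "pcas u p v \<Longrightarrow> tl (pawalk_verts u p) = map snd p"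
proof (induction p arbitrary: u)
  case (Cons e p)
  then show ?case by (cases p) auto
qed simp

lemma pcas_nth:
  assumes "pcas u p v"
  shows "(Suc i < length p \<longrightarrow> fst (p ! Suc i) = snd (p ! i)) \<and>
    (p \<noteq> [] \<longrightarrow> fst (p ! 0) = u \<and> snd (last p) = v)"
  using assms
proof (induction p arbitrary: u i)
  case (Cons e p)
  then have *: "(Suc i < length p \<longrightarrow> fst (p ! Suc i) = snd (p ! i)) \<and>
    (p \<noteq> [] \<longrightarrow> fst (p ! 0) = snd e \<and> snd (last p) = v)" for i
    by auto
  from Cons.prems have "fst e = u" "p = [] \<Longrightarrow> snd e = v"
    by (auto split: if_splits)
  with * show ?case
    by (cases i) auto
qed simp

lemma closed_walk_step:
  assumes "pcas u p u" "i < length p"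
  shows "fst (p ! (Suc i mod length p)) = snd (p ! i)"
proof (cases "Suc i = length p")
  case True
  then have "i = length p - 1" "p \<noteq> []"
    by auto
  then have "p ! i = last p"
    by (simp add: last_conv_nth)
  with True \<open>p \<noteq> []\<close> show ?thesis
    using pcas_nth[OF assms(1)] by simp
next
  case False
  then show ?thesis
    using pcas_nth[OF assms(1), of i] assms(2) by simp
qed

context rooted_forest
begin

text \<open>
  Both neighbours on the cycle of its largest vertex are smaller than it, so both are its parent. On
  a cycle of length at least 3 the two neighbours are distinct.
\<close>

lemma acyclic_tree_on:
  assumes "0 \<notin> S" "pre_digraph.cycle (with_proj (tree_on S)) p"
  shows "length p < 3"
proof (rule ccontr)
  let ?n = "length p"
  assume "\<not> ?n < 3"
  obtain u where arcs: "set p \<subseteq> parcs (tree_on S)" and closed: "pcas u p u"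
    and "distinct (tl (pawalk_verts u p))" and "p \<noteq> []"
    using assms(2) by (auto simp: pre_digraph.cycle_def pre_digraph.awalk_def
        cas_with_proj_eq awalk_verts_with_proj_eq)
  then have dist: "distinct (map snd p)"
    by (simp add: tl_pawalk_verts)
  define m where "m = Max (snd ` set p)"
  have "m \<in> snd ` set p"
    unfolding m_def using \<open>p \<noteq> []\<close> by (intro Max_in) auto
  then obtain j where j: "j < ?n" "snd (p ! j) = m"
    by (metis imageE in_set_conv_nth)
  \<comment> \<open>Arc \<open>j\<close> ends in the largest vertex \<open>m\<close>; arc \<open>i\<close> is its cyclic predecessor and arc \<open>k\<close> its
    successor, so the neighbours of \<open>m\<close> are the heads of arcs \<open>i\<close> and \<open>k\<close>.\<close>
  define i where "i = (if j = 0 then ?n - 1 else j - 1)"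
  define k where "k = Suc j mod ?n"
  have i: "i < ?n" "Suc i mod ?n = j" and k: "k < ?n"
    using j \<open>p \<noteq> []\<close> by (auto simp: i_def k_def)
  have "i \<noteq> k"
    using \<open>\<not> ?n < 3\<close> j(1) by (auto simp: i_def k_def mod_Suc split: if_splits)
  have max: "snd (p ! l) \<le> m" if "l < ?n" for l
    using that by (simp add: m_def)
  have parent: "parent (snd (p ! l)) \<noteq> m" if "l < ?n" for l
  proof
    assume *: "parent (snd (p ! l)) = m"
    have "p ! l \<in> parcs (tree_on S)"
      using arcs that by auto
    then have "snd (p ! l) \<in> S"
      by (auto simp: tree_on_def)
    then show False
      using \<open>0 \<notin> S\<close> * max[OF that] parent_less[of "snd (p ! l)"] by (cases "snd (p ! l)") auto
  qed
  have "p ! j \<in> parcs (tree_on S)" "p ! k \<in> parcs (tree_on S)"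
    using arcs j k by auto
  moreover have "fst (p ! j) = snd (p ! i)" "fst (p ! k) = m"
    using closed_walk_step[OF closed i(1)] closed_walk_step[OF closed j(1)] i(2) j(2)
    by (simp_all add: k_def)
  ultimately have "snd (p ! i) = parent m" "snd (p ! k) = parent m"
    using parent[OF i(1)] parent[OF k] j(2) by (auto simp: tree_on_def)
  then have "map snd p ! i = map snd p ! k"
    using i k by simp
  then show False
    using dist i(1) k \<open>i \<noteq> k\<close> by (auto simp: distinct_conv_nth)
qed

lemma undirected_tree_tree_on:
  assumes "finite S" "rooted S r"
  shows "undirected_tree (tree_on S)"
proof -
  have "0 \<notin> S"
    using assms by (simp add: rooted_def)
  then show ?thesis
    using pair_graph_tree_on[OF assms(1)] connected_tree_on[OF assms] acyclic_tree_on
    unfolding undirected_tree_def by (metis not_less)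
qed

definition fan :: "nat set \<Rightarrow> nat pair_pre_digraph" where
  "fan S = add_universal_vertex 0 (tree_on S)"

lemma pverts_fan: "pverts (fan S) = insert 0 S"
  by (simp add: fan_def add_universal_vertex_def tree_on_def)

lemma arc_fan_iff:
  "(u, v) \<in> parcs (fan S) \<longleftrightarrow>
    u \<in> S \<and> v \<in> S \<and> (parent u = v \<or> parent v = u) \<or> u = 0 \<and> v \<in> S \<or> u \<in> S \<and> v = 0"
  by (auto simp: fan_def add_universal_vertex_def tree_on_def)

lemma tree_apex_graph_fan:
  assumes "finite S" "rooted S r"
  shows "tree_apex_graph (fan S)"
proof -
  have "0 \<notin> pverts (tree_on S)"
    using assms by (simp add: rooted_def tree_on_def)
  then show ?thesis
    using undirected_tree_tree_on[OF assms] unfolding tree_apex_graph_def fan_def by blast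
qed

lemma pair_graph_fan:
  assumes "finite S" "0 \<notin> S"
  shows "pair_graph (fan S)"
  unfolding fan_def using assms
  by (intro pair_graph_add_universal_vertex pair_graph_tree_on) (simp_all add: tree_on_def)

section \<open>Series-parallel decomposition\<close>

lemma parcs_fan_disjoint:
  assumes "S \<inter> D = {}" "0 \<notin> S" "0 \<notin> D" "c \<in> D"
  shows "parcs (fan S) \<inter> parcs (pair_union \<lparr>pverts = {v, c}, parcs = {(v, c), (c, v)}\<rparr> (fan D)) = {}"
proof -
  have "x \<in> insert 0 S \<and> y \<in> insert 0 S" if "(x, y) \<in> parcs (fan S)" for x y
    using that unfolding arc_fan_iff by blast
  moreover have "x \<in> D \<or> y \<in> D"
    if "(x, y) \<in> parcs (pair_union \<lparr>pverts = {v, c}, parcs = {(v, c), (c, v)}\<rparr> (fan D))" for x y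
    using that \<open>c \<in> D\<close> unfolding pair_union_def by (auto simp: arc_fan_iff)
  moreover have "x \<notin> D" if "x \<in> insert 0 S" for x
    using that assms by blast
  ultimately show ?thesis
    by (metis disjoint_iff surj_pair)
qed

text \<open>
  Attaching one more subtree below \<open>v\<close> amounts to a parallel composition, because the only tree edge
  between the new part \<open>D\<close> and the old part \<open>insert v U\<close> is the one from the root \<open>c\<close> of \<open>D\<close> to \<open>v\<close>.
\<close>

lemma fan_attach_subtree:
  assumes "U \<inter> D = {}" "v \<notin> U" "v \<notin> D" "c \<in> D" "parent c = v" "parent v \<notin> D"
    and "\<And>u. u \<in> U \<Longrightarrow> parent u \<in> insert v U" "\<And>u. u \<in> D \<Longrightarrow> u \<noteq> c \<Longrightarrow> parent u \<in> D"
  shows "pair_union (fan (insert v U)) (pair_union \<lparr>pverts = {v, c}, parcs = {(v, c), (c, v)}\<rparr> (fan D)) =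
    fan (insert v (U \<union> D))"
    (is "?L = ?R")
proof (rule pair_pre_digraph.equality)
  have link: "parent x = y \<longleftrightarrow> x = c \<and> y = v" "parent y \<noteq> x" if "x \<in> D" "y \<in> insert v U" for x y
  proof -
    show "parent x = y \<longleftrightarrow> x = c \<and> y = v"
      using that assms(1,3,5) assms(8)[of x] by (cases "x = c") auto
    show "parent y \<noteq> x"
      using that assms(1,3,6) assms(7)[of y] by (cases "y = v") auto
  qed
  have "(x, y) \<in> parcs ?L \<longleftrightarrow> (x, y) \<in> parcs ?R" for x y
  proof -
    define S where "S = insert v U"
    have "(x, y) \<in> parcs ?L \<longleftrightarrow> (x, y) \<in> parcs (fan S) \<or> (x, y) \<in> parcs (fan D) \<or>
        x = v \<and> y = c \<or> x = c \<and> y = v"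
      unfolding S_def by (auto simp: pair_union_def)
    also have "\<dots> \<longleftrightarrow> (x, y) \<in> parcs (fan (S \<union> D))"
      using link[folded S_def] \<open>c \<in> D\<close> assms(5) S_def unfolding arc_fan_iff by blast
    finally show ?thesis
      by (simp add: S_def)
  qed
  then show "parcs ?L = parcs ?R"
    by (intro set_eqI) (simp add: split_paired_all)
qed (use \<open>c \<in> D\<close> in \<open>auto simp: pverts_fan pair_union_def\<close>)

text \<open>
  The children of \<open>v\<close> are attached one at a time. The induction over the set of attached children
  starts from the single edge between \<open>v\<close> and the apex, so this edge is added only once.
\<close>

lemma two_terminal_sp_fan:
  assumes "\<And>v. 0 < v \<Longrightarrow> finite (children v)" "0 < v"
  shows "two_terminal_sp (fan (descendants n v)) v 0"
  using \<open>0 < v\<close>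
proof (induction n arbitrary: v)
  case 0
  then have "parent v \<noteq> v"
    using parent_less[of v] by simp
  then have "fan {v} = \<lparr>pverts = {v, 0}, parcs = {(v, 0), (0, v)}\<rparr>"
    using 0 by (auto simp: fan_def add_universal_vertex_def tree_on_def)
  then show ?case
    using 0 two_terminal_sp.edge[of v 0] by (simp add: descendants_zero)
next
  case (Suc n)
  have loop: "parent v \<noteq> v"
    using parent_less[of v] Suc.prems by simp
  have "two_terminal_sp (fan (insert v (\<Union>c\<in>C. descendants n c))) v 0"
    if "finite C" "C \<subseteq> children v" for C
    using that
  proof (induction C rule: finite_induct)
    case empty
    have "fan {v} = \<lparr>pverts = {v, 0}, parcs = {(v, 0), (0, v)}\<rparr>"
      using Suc.prems loop by (auto simp: fan_def add_universal_vertex_def tree_on_def)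
    then show ?case
      using Suc.prems two_terminal_sp.edge[of v 0] by simp
  next
    case (insert c C)
    let ?U = "\<Union>c\<in>C. descendants n c" and ?D = "descendants n c"
    let ?E = "\<lparr>pverts = {v, c}, parcs = {(v, c), (c, v)}\<rparr>"
    have c: "c \<in> children v" "v < c" and C: "C \<subseteq> children v"
      using insert.prems children_greater by auto
    have above: "v < u" "u = d \<and> parent u = v \<or> parent u \<in> descendants n d"
      if "d \<in> children v" "u \<in> descendants n d" for d u
    proof -
      have "v < d"
        using children_greater[OF that(1)] .
      then show "v < u"
        using descendants_ge[OF that(2)] by simp
      have "rooted (descendants n d) d"
        using \<open>v < d\<close> by (intro rooted_descendants) simp
      then show "u = d \<and> parent u = v \<or> parent u \<in> descendants n d"
        using that by (cases "u = d") (auto simp: rooted_def children_def)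
    qed
    have U: "0 \<notin> ?U" "v \<notin> ?U" "\<And>u. u \<in> ?U \<Longrightarrow> parent u \<in> insert v ?U"
      using above C by blast+
    have D: "0 \<notin> ?D" "v \<notin> ?D" "\<And>u. u \<in> ?D \<Longrightarrow> u \<noteq> c \<Longrightarrow> parent u \<in> ?D"
      using above[OF c(1)] by blast+
    have "c \<in> ?D"
      using rooted_descendants[of c n] c(2) by (simp add: rooted_def)
    have disj: "?U \<inter> ?D = {}"
      using descendants_children_disjoint[OF _ c(1)] C insert.hyps(2) by blast
    have "two_terminal_sp (pair_union ?E (fan ?D)) v 0"
    proof (rule two_terminal_sp.series)
      show "two_terminal_sp ?E v c"
        using c by (intro two_terminal_sp.edge) simp
      show "two_terminal_sp (fan ?D) c 0"
        using c Suc.prems by (intro Suc.IH) simp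
      show "pverts ?E \<inter> pverts (fan ?D) = {c}"
        using D(2) \<open>c \<in> ?D\<close> Suc.prems by (auto simp: pverts_fan)
    qed
    moreover have "two_terminal_sp (fan (insert v ?U)) v 0"
      using insert.IH C by blast
    moreover have "pverts (fan (insert v ?U)) \<inter> pverts (pair_union ?E (fan ?D)) = {v, 0}"
      using D(1,2) U(1,2) disj \<open>c \<in> ?D\<close> unfolding pverts_fan pair_union_def by auto
    moreover have "parcs (fan (insert v ?U)) \<inter> parcs (pair_union ?E (fan ?D)) = {}"
      using D(1,2) U(1) disj Suc.prems \<open>c \<in> ?D\<close> by (intro parcs_fan_disjoint) auto
    ultimately have "two_terminal_sp (pair_union (fan (insert v ?U)) (pair_union ?E (fan ?D))) v 0"
      by - (rule two_terminal_sp.parallel)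
    moreover have "pair_union (fan (insert v ?U)) (pair_union ?E (fan ?D)) = fan (insert v (?U \<union> ?D))"
    proof (rule fan_attach_subtree)
      show "parent c = v" "c \<in> ?D"
        using c \<open>c \<in> ?D\<close> by (auto simp: children_def)
      show "parent v \<notin> ?D"
        using above(1)[OF c(1)] parent_less[OF Suc.prems] by fastforce
    qed (use U D disj in blast)+
    ultimately show ?case
      by (simp add: Un_commute)
  qed
  from this[of "children v"] show ?case
    using assms(1) Suc.prems by (simp add: descendants_Suc)
qed

end

section \<open>Track layouts\<close>

lemma precedes_sorted_list_of_set:
  assumes "precedes (sorted_list_of_set A) u v"
  shows "u < (v :: nat)"
  using assms sorted_wrt_nth_less[OF strict_sorted_list_of_set[of A]]
  by (auto simp: precedes_def)

context rooted_forest
begin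

definition depth :: "nat \<Rightarrow> nat" where
  "depth v = (LEAST k. (parent ^^ k) v = 0)"

lemma depth_parent:
  assumes "0 < v"
  shows "depth v = Suc (depth (parent v))"
proof -
  have "\<exists>k. (parent ^^ k) u = 0" for u
  proof (induction u rule: less_induct)
    case (less u)
    show ?case
    proof (cases "u = 0")
      case True
      then show ?thesis by (intro exI[of _ 0]) simp
    next
      case False
      then obtain k where "(parent ^^ k) (parent u) = 0"
        using less parent_less[of u] by auto
      then show ?thesis
        by (intro exI[of _ "Suc k"]) (simp add: funpow_swap1)
    qed
  qed
  then obtain k where "(parent ^^ k) v = 0"
    by blast
  then have "depth v = Suc (LEAST k. (parent ^^ Suc k) v = 0)"
    unfolding depth_def using assms by (intro Least_Suc) auto
  then show ?thesis
    by (simp add: depth_def funpow_swap1)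
qed

definition track :: "nat set \<Rightarrow> nat \<Rightarrow> nat list" where
  "track S i = sorted_list_of_set {v \<in> S. depth v mod 3 = i}"

text \<open>
  The depths of the ends of a tree edge differ by exactly 1, so their residues modulo 3 differ and
  also reveal which end is the parent. Two edges between the same two tracks are therefore directed
  alike, and as \<open>parent\<close> is monotone, their child ends cannot appear in the order opposite to that of
  their parent ends.
\<close>

lemma track_layout_fan:
  assumes "finite S" "0 \<notin> S" "mono parent"
  shows "track_layout (fan S) [[0], track S 0, track S 1, track S 2]"
proof -
  let ?ts = "[[0], track S 0, track S 1, track S 2]"
  have set_track: "set (track S i) = {v \<in> S. depth v mod 3 = i}" for i
    using assms(1) by (simp add: track_def)
  have "depth v mod 3 = 0 \<or> depth v mod 3 = 1 \<or> depth v mod 3 = 2" for v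
    using mod_less_divisor[of 3 "depth v"] by linarith
  then have "set (concat ?ts) = pverts (fan S)"
    by (auto simp: set_track pverts_fan)
  moreover have "distinct (track S i)" for i
    by (simp add: track_def)
  then have "distinct (concat ?ts)"
    using assms(2) by (auto simp: set_track)
  moreover have depth: "depth u mod 3 \<noteq> depth v mod 3" "parent u = v \<longleftrightarrow> depth u mod 3 = Suc (depth v) mod 3"
    if "(u, v) \<in> parcs (fan S)" "u \<in> S" "v \<in> S" for u v
  proof -
    have "depth u = Suc (depth v)" if "parent u = v"
      using depth_parent[of u] that \<open>u \<in> S\<close> assms(2) by (cases "u = 0") auto
    moreover have "depth v = Suc (depth u)" if "parent v = u"
      using depth_parent[of v] that \<open>v \<in> S\<close> assms(2) by (cases "v = 0") auto
    moreover have "parent u = v \<or> parent v = u"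
      using that assms(2) by (auto simp: arc_fan_iff)
    moreover have "Suc k mod 3 \<noteq> k mod 3" "Suc (Suc k) mod 3 \<noteq> k mod 3" for k
      by presburger+
    ultimately show "depth u mod 3 \<noteq> depth v mod 3" "parent u = v \<longleftrightarrow> depth u mod 3 = Suc (depth v) mod 3"
      by metis+
  qed
  have "(u, v) \<notin> parcs (fan S)" if "t \<in> set ?ts" "u \<in> set t" "v \<in> set t" for t u v
  proof
    assume arc: "(u, v) \<in> parcs (fan S)"
    from that(1) consider "t = [0]" | i where "t = track S i"
      by auto
    then show False
    proof cases
      case 1
      then show False using arc that assms(2) by (auto simp: arc_fan_iff)
    next
      case (2 i)
      then show False using that depth(1)[OF arc] by (auto simp: set_track)
    qed
  qed
  moreover have False
    if ij: "i < length ?ts" "j < length ?ts" "i \<noteq> j"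
      and arcs: "(u, v) \<in> parcs (fan S)" "(u', v') \<in> parcs (fan S)"
      and prec: "precedes (?ts ! i) u u'" "precedes (?ts ! j) v' v" for i j u v u' v'
  proof -
    have "\<not> precedes [0] x y" for x y :: nat
      by (auto simp: precedes_def)
    then have "i \<noteq> 0" "j \<noteq> 0"
      using prec by (metis nth_Cons_0)+
    moreover have "\<exists>a. ?ts ! l = track S a" if "l < length ?ts" "l \<noteq> 0" for l
    proof -
      have "?ts ! l \<in> set [track S 0, track S 1, track S 2]"
        using that nth_mem[of "l - 1" "[track S 0, track S 1, track S 2]"] by (cases l) simp_all
      then show ?thesis by auto
    qed
    ultimately obtain a b where ab: "?ts ! i = track S a" "?ts ! j = track S b"
      using ij by blast
    then have less: "u < u'" "v' < v"
      using prec precedes_sorted_list_of_set unfolding track_def by metis+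
    have "{u, u'} \<subseteq> set (track S a)" "{v, v'} \<subseteq> set (track S b)"
      using prec unfolding ab by (auto simp: precedes_def)
    then have mem: "u \<in> S" "u' \<in> S" "v \<in> S" "v' \<in> S" "depth u mod 3 = depth u' mod 3"
      "depth v mod 3 = depth v' mod 3"
      by (auto simp: set_track)
    have same: "parent u = v \<longleftrightarrow> parent u' = v'"
      unfolding depth(2)[OF arcs(1) mem(1,3)] depth(2)[OF arcs(2) mem(2,4)]
      using mem by (simp add: mod_Suc)
    show False
    proof (cases "parent u = v")
      case True
      then show False
        using same monoD[OF assms(3), of u u'] less by simp
    next
      case False
      then have "parent v = u" "parent v' = u'"
        using same arcs mem assms(2) by (auto simp: arc_fan_iff)
      then show False
        using monoD[OF assms(3), of v' v] less by simp
    qed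
  qed
  ultimately show ?thesis
    unfolding track_layout_def by blast
qed

lemma track_number_fan:
  assumes "finite S" "0 \<notin> S" "mono parent"
  shows "track_number (fan S) \<le> 4"
  unfolding track_number_def
  by (rule Least_le, rule exI, rule conjI[OF _ track_layout_fan[OF assms]]) simp

end

section \<open>Lower bound on layered pathwidth\<close>

text \<open>
  All vertices lie in the layer of the universal vertex or in one of the two layers next to it.
\<close>

lemma card_bag_le_universal_vertex:
  assumes layering: "layering G Ls" and width: "layered_width_le Bs Ls k"
    and "B \<in> set Bs" "B \<subseteq> pverts G" "finite B"
    and "a \<in> pverts G" and universal: "\<And>v. v \<in> pverts G \<Longrightarrow> v \<noteq> a \<Longrightarrow> (a, v) \<in> parcs G"
  shows "card B \<le> 3 * k"
proof -
  obtain i where i: "i < length Ls" "a \<in> Ls ! i"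
    using layering \<open>a \<in> pverts G\<close> unfolding layering_def by (metis UnionE in_set_conv_nth)
  \<comment> \<open>If \<open>i = 0\<close>, truncated subtraction merely repeats index 0.\<close>
  define I where "I = {i - 1, i, Suc i} \<inter> {..<length Ls}"
  have "B \<subseteq> (\<Union>j\<in>I. B \<inter> Ls ! j)"
  proof
    fix v assume "v \<in> B"
    then obtain j where j: "j < length Ls" "v \<in> Ls ! j"
      using layering \<open>B \<subseteq> pverts G\<close> unfolding layering_def by (metis UnionE in_set_conv_nth subsetD)
    have "j \<in> {i - 1, i, Suc i}"
    proof (cases "v = a")
      case True
      then show ?thesis
        using layering i j unfolding layering_def by blast
    next
      case False
      then have "(a, v) \<in> parcs G"
        using universal \<open>v \<in> B\<close> \<open>B \<subseteq> pverts G\<close> by blast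
      then have "i \<le> Suc j \<and> j \<le> Suc i"
        using layering i j unfolding layering_def by blast
      then show ?thesis by auto
    qed
    with j \<open>v \<in> B\<close> show "v \<in> (\<Union>j\<in>I. B \<inter> Ls ! j)"
      by (auto simp: I_def)
  qed
  then have "card B \<le> card (\<Union>j\<in>I. B \<inter> Ls ! j)"
    using \<open>finite B\<close> by (intro card_mono) (auto simp: I_def)
  also have "\<dots> \<le> (\<Sum>j\<in>I. card (B \<inter> Ls ! j))"
    by (intro card_UN_le) (simp add: I_def)
  also have "\<dots> \<le> card I * k"
    using width \<open>B \<in> set Bs\<close> sum_bounded_above[of I "\<lambda>j. card (B \<inter> Ls ! j)" k]
    by (auto simp: layered_width_le_def I_def)
  also have "card I \<le> 3"
    using card_mono[of "{i - 1, i, Suc i}" I] card_insert_le_m1[of 3 "{i, Suc i}" "i - 1"]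
    by (auto simp: I_def)
  finally show ?thesis
    by simp
qed

lemma layered_pathwidth_attained:
  assumes "pair_graph G"
  obtains Bs Ls where "path_decomposition G Bs" "layering G Ls"
    "layered_width_le Bs Ls (layered_pathwidth G)"
  using LeastI_ex[OF ex_layered_path_decomposition[OF assms]] that
  unfolding layered_pathwidth_def by blast

lemma bags_of_vertex_contiguous:
  assumes "path_decomposition G Bs" "v \<in> pverts G"
    and "v \<in> Bs ! i" "v \<in> Bs ! k" "i \<le> j" "j \<le> k" "k < length Bs"
  shows "v \<in> Bs ! j"
proof -
  obtain a b where "{k. k < length Bs \<and> v \<in> Bs ! k} = {a..b}"
    using assms(1,2) unfolding path_decomposition_def by blast
  then have *: "k < length Bs \<and> v \<in> Bs ! k \<longleftrightarrow> a \<le> k \<and> k \<le> b" for k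
    by (auto simp: set_eq_iff)
  from assms(3-) show ?thesis
    using *[of i] *[of j] *[of k] by auto
qed

context rooted_forest
begin

text \<open>
  A connected subgraph occupies a contiguous range of bags. If bag \<open>j\<close> missed \<open>A\<close>, every vertex of
  \<open>A\<close> would have all its bags before \<open>j\<close> or all after \<open>j\<close>. A vertex shares a bag with its parent,
  so all of \<open>A\<close> would lie on the side of the root, against the hypothesis on bags \<open>i\<close> and \<open>k\<close>.
\<close>

lemma bags_of_rooted_contiguous:
  assumes pd: "path_decomposition G Bs" and "rooted A r"
    and "A \<subseteq> pverts G" "parcs (tree_on A) \<subseteq> parcs G"
    and "i \<le> j" "j \<le> k" "k < length Bs" "A \<inter> Bs ! i \<noteq> {}" "A \<inter> Bs ! k \<noteq> {}"
  shows "A \<inter> Bs ! j \<noteq> {}"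
proof
  assume gap: "A \<inter> Bs ! j = {}"
  have same_side: "l < j \<longleftrightarrow> m < j"
    if "u \<in> A" "u \<in> Bs ! l" "u \<in> Bs ! m" "l < length Bs" "m < length Bs" for u l m
    using bags_of_vertex_contiguous[OF pd, of u l m j] bags_of_vertex_contiguous[OF pd, of u m l j]
      that gap \<open>A \<subseteq> pverts G\<close> by (meson disjoint_iff not_less order_less_imp_le subsetD)
  have "l < j \<longleftrightarrow> m < j"
    if "u \<in> A" "u \<in> Bs ! l" "l < length Bs" "r \<in> Bs ! m" "m < length Bs" for u l m
    using that(1-3)
  proof (induction u arbitrary: l rule: less_induct)
    case (less u)
    show ?case
    proof (cases "u = r")
      case True
      then show ?thesis using same_side[of u l m] less.prems that by blast
    next
      case False
      then have p: "parent u \<in> A" "parent u < u"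
        using less.prems(1) \<open>rooted A r\<close> parent_less[of u] by (cases "u = 0"; auto simp: rooted_def)+
      then have "(u, parent u) \<in> parcs G"
        using less.prems(1) \<open>parcs (tree_on A) \<subseteq> parcs G\<close> by (auto simp: tree_on_def)
      then obtain B where "B \<in> set Bs" "u \<in> B" "parent u \<in> B"
        using pd unfolding path_decomposition_def by blast
      then obtain q where "q < length Bs" "u \<in> Bs ! q" "parent u \<in> Bs ! q"
        by (auto simp: in_set_conv_nth)
      then show ?thesis
        using less.IH[of "parent u" q] same_side[of u l q] less.prems p by blast
    qed
  qed
  moreover obtain m where "m < length Bs" "r \<in> Bs ! m"
  proof -
    have "r \<in> pverts G"
      using assms(2,3) by (auto simp: rooted_def)
    then obtain a b where "a \<le> b" "{k. k < length Bs \<and> r \<in> Bs ! k} = {a..b}"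
      using pd unfolding path_decomposition_def by blast
    then have "a \<in> {k. k < length Bs \<and> r \<in> Bs ! k}"
      by simp
    then show ?thesis using that by blast
  qed
  moreover obtain x y where "x \<in> A" "x \<in> Bs ! i" "y \<in> A" "y \<in> Bs ! k"
    using assms by blast
  moreover have "i < length Bs"
    using assms by simp
  ultimately have "i < j \<longleftrightarrow> k < j"
    using \<open>k < length Bs\<close> by blast
  moreover have "i \<noteq> j"
    using gap \<open>x \<in> A\<close> \<open>x \<in> Bs ! i\<close> by blast
  ultimately show False
    using assms by simp
qed

end

lemma middle_of_three:
  fixes f :: "'a \<Rightarrow> 'b :: linorder"
  assumes "3 \<le> card C"
  obtains a b c where "a \<in> C" "b \<in> C" "c \<in> C" "a \<noteq> b" "b \<noteq> c" "f a \<le> f b" "f b \<le> f c"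
proof -
  obtain T where "T \<subseteq> C" "card T = 3"
    using obtain_subset_with_card_n[OF assms] by metis
  then obtain x y z where "{x, y, z} \<subseteq> C" "x \<noteq> y" "x \<noteq> z" "y \<noteq> z"
    by (auto simp: card_3_iff)
  then show ?thesis
    using that[of x y z] that[of x z y] that[of y x z] that[of y z x] that[of z x y] that[of z y x]
    by (metis insert_subset linear)
qed

context rooted_forest
begin

text \<open>
  This is the classical argument that complete ternary trees have unbounded pathwidth. Three children
  are needed so that one of the three bags supplied by induction lies between the other two.
\<close>

lemma ex_large_bag:
  assumes pd: "path_decomposition G Bs"
    and branching: "\<And>v. 0 < v \<Longrightarrow> 3 \<le> card (children v)"
    and "0 < v" "descendants n v \<subseteq> pverts G" "parcs (tree_on (descendants n v)) \<subseteq> parcs G"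
  shows "\<exists>j<length Bs. Suc n \<le> card (Bs ! j \<inter> descendants n v)"
  using assms(3-)
proof (induction n arbitrary: v)
  case 0
  then have "v \<in> pverts G"
    by (simp add: descendants_zero)
  then obtain a b where "a \<le> b" "{k. k < length Bs \<and> v \<in> Bs ! k} = {a..b}"
    using pd unfolding path_decomposition_def by blast
  then have "a \<in> {k. k < length Bs \<and> v \<in> Bs ! k}"
    by simp
  then show ?case
    by (auto simp: descendants_zero intro!: exI[of _ a])
next
  case (Suc n)
  let ?D = "descendants n"
  have sub: "?D c \<subseteq> descendants (Suc n) v" if "c \<in> children v" for c
    using that Suc.prems(1) by (auto simp: descendants_Suc)
  have "\<exists>j<length Bs. Suc n \<le> card (Bs ! j \<inter> ?D c)" if "c \<in> children v" for c
  proof (rule Suc.IH)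
    show "0 < c"
      using that by (simp add: children_def)
    show "?D c \<subseteq> pverts G"
      using sub[OF that] Suc.prems(2) by blast
    show "parcs (tree_on (?D c)) \<subseteq> parcs G"
      using sub[OF that] Suc.prems(3) by (force simp: tree_on_def)
  qed
  then obtain pos where pos: "\<And>c. c \<in> children v \<Longrightarrow> pos c < length Bs"
    "\<And>c. c \<in> children v \<Longrightarrow> Suc n \<le> card (Bs ! pos c \<inter> ?D c)"
    by metis
  obtain a b c where abc: "a \<in> children v" "b \<in> children v" "c \<in> children v" "a \<noteq> b" "b \<noteq> c"
    "pos a \<le> pos b" "pos b \<le> pos c"
    using middle_of_three[OF branching[OF Suc.prems(1)]] by metis
  \<comment> \<open>\<open>A\<close> is connected through \<open>v\<close>, meets a bag on either side of the bag of \<open>b\<close>, and avoids the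
    subtree below \<open>b\<close>; so it contributes a new vertex \<open>w\<close> to that bag.\<close>
  define A where "A = insert v (?D a \<union> ?D c)"
  have "rooted A v"
    using rooted_descendants[of a n] rooted_descendants[of c n] abc(1,3) Suc.prems(1)
    by (auto simp: rooted_def A_def children_def)
  have A: "A \<subseteq> descendants (Suc n) v"
    using abc sub Suc.prems(1) by (auto simp: A_def descendants_Suc)
  have "A \<inter> Bs ! pos b \<noteq> {}"
  proof (rule bags_of_rooted_contiguous[OF pd \<open>rooted A v\<close>])
    show "A \<subseteq> pverts G"
      using A Suc.prems(2) by blast
    show "parcs (tree_on A) \<subseteq> parcs G"
      using A Suc.prems(3) by (force simp: tree_on_def)
    have "Bs ! pos x \<inter> ?D x \<noteq> {}" if "x \<in> children v" for x
      using pos(2)[OF that] by auto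
    then show "A \<inter> Bs ! pos a \<noteq> {}" "A \<inter> Bs ! pos c \<noteq> {}"
      using abc by (auto simp: A_def)
  qed (use abc pos in auto)
  then obtain w where w: "w \<in> A" "w \<in> Bs ! pos b"
    by blast
  have "w \<notin> ?D b"
    using w(1) descendants_children_disjoint[of a v b n] descendants_children_disjoint[of c v b n]
      abc children_greater[of b v] descendants_ge[of w n b] by (auto simp: A_def)
  have fin: "finite (descendants (Suc n) v)"
    using finite_descendants[OF _ Suc.prems(1)] branching by (metis card.infinite not_numeral_le_zero)
  then have "finite (?D b)"
    using sub abc(2) finite_subset by blast
  then have "Suc (card (Bs ! pos b \<inter> ?D b)) = card (insert w (Bs ! pos b \<inter> ?D b))"
    using \<open>w \<notin> ?D b\<close> by simp
  also have "\<dots> \<le> card (Bs ! pos b \<inter> descendants (Suc n) v)"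
    using fin w A sub[OF abc(2)] by (intro card_mono) auto
  finally show ?case
    using pos abc(2) by (intro exI[of _ "pos b"]) fastforce
qed

lemma layered_pathwidth_fan_ge:
  assumes branching: "\<And>v. 0 < v \<Longrightarrow> 3 \<le> card (children v)" and "0 < v"
  shows "n \<le> 3 * layered_pathwidth (fan (descendants n v))"
proof -
  let ?D = "descendants n v"
  have fin: "finite ?D"
    using finite_descendants[OF _ \<open>0 < v\<close>] branching by (metis card.infinite not_numeral_le_zero)
  have "0 \<notin> ?D"
    using rooted_descendants[OF \<open>0 < v\<close>] by (auto simp: rooted_def)
  then obtain Bs Ls where pd: "path_decomposition (fan ?D) Bs" and Ls: "layering (fan ?D) Ls"
    "layered_width_le Bs Ls (layered_pathwidth (fan ?D))"
    using layered_pathwidth_attained pair_graph_fan fin by metis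
  have "parcs (tree_on ?D) \<subseteq> parcs (fan ?D)"
    by (auto simp: fan_def add_universal_vertex_def)
  then obtain j where j: "j < length Bs" "Suc n \<le> card (Bs ! j \<inter> ?D)"
    using ex_large_bag[OF pd branching \<open>0 < v\<close>] by (auto simp: pverts_fan)
  then have B: "Bs ! j \<in> set Bs" "Bs ! j \<subseteq> insert 0 ?D"
    using pd by (auto simp: path_decomposition_def pverts_fan)
  then have "finite (Bs ! j)"
    using fin finite_subset by blast
  have "card (Bs ! j) \<le> 3 * layered_pathwidth (fan ?D)"
  proof (rule card_bag_le_universal_vertex[OF Ls B(1) _ \<open>finite (Bs ! j)\<close>, of 0])
  qed (use B(2) in \<open>auto simp: pverts_fan arc_fan_iff\<close>)
  moreover have "card (Bs ! j \<inter> ?D) \<le> card (Bs ! j)"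
    using \<open>finite (Bs ! j)\<close> by (intro card_mono) auto
  ultimately show ?thesis
    using j by linarith
qed

end

section \<open>Upper bound on layered pathwidth\<close>

lemma nat_interval_if_convex:
  fixes I :: "nat set"
  assumes "finite I" "I \<noteq> {}" "\<And>i j k. i \<in> I \<Longrightarrow> k \<in> I \<Longrightarrow> i \<le> j \<Longrightarrow> j \<le> k \<Longrightarrow> j \<in> I"
  shows "\<exists>a b. a \<le> b \<and> I = {a..b}"
proof (intro exI conjI)
  show "I = {Min I..Max I}"
  proof (intro equalityI subsetI)
    show "x \<in> {Min I..Max I}" if "x \<in> I" for x
      using that assms(1) by simp
    show "x \<in> I" if "x \<in> {Min I..Max I}" for x
      using that assms(3)[OF Min_in[OF assms(1,2)] Max_in[OF assms(1,2)]] by simp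
  qed
  show "Min I \<le> Max I"
    using assms(1,2) by simp
qed

lemma layered_pathwidth_le:
  assumes "path_decomposition G Bs" "\<And>B. B \<in> set Bs \<Longrightarrow> finite B \<and> card B \<le> k"
  shows "layered_pathwidth G \<le> k"
proof -
  have "layering G [pverts G]"
    by (auto simp: layering_def)
  moreover have "card (B \<inter> pverts G) \<le> k" if "B \<in> set Bs" for B
    using assms(2)[OF that] card_mono[of B "B \<inter> pverts G"] by auto
  then have "layered_width_le Bs [pverts G] k"
    by (simp add: layered_width_le_def)
  ultimately show ?thesis
    unfolding layered_pathwidth_def using assms(1) by (intro Least_le) blast
qed

context rooted_forest
begin

text \<open>
  These are the leaves of \<open>descendants n r\<close> when every vertex has a child.
\<close>

definition leaves :: "nat \<Rightarrow> nat \<Rightarrow> nat set" where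
  "leaves n r = {l. (parent ^^ n) l = r}"

definition leaf_bag :: "nat \<Rightarrow> nat \<Rightarrow> nat set" where
  "leaf_bag n l = insert 0 ((\<lambda>k. (parent ^^ k) l) ` {..n})"

text \<open>Every vertex of the truncated tree lies in a bag, because it can be extended downwards to level \<open>n\<close>.\<close>

lemma ex_leaf_below:
  assumes "\<And>v. 0 < v \<Longrightarrow> children v \<noteq> {}" "0 < r" "u \<in> descendants n r"
  shows "\<exists>l k. l \<in> leaves n r \<and> k \<le> n \<and> (parent ^^ k) l = u"
proof -
  have deep: "\<exists>l. (parent ^^ k) l = v" if "0 < v" for k v
    using that
  proof (induction k arbitrary: v)
    case 0
    then show ?case by simp
  next
    case (Suc k)
    then obtain c where "c \<in> children v"
      using assms(1) by blast
    then obtain l where "(parent ^^ k) l = c"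
      using Suc.IH[of c] by (auto simp: children_def)
    then show ?case
      using \<open>c \<in> children v\<close> by (auto simp: children_def)
  qed
  obtain k where k: "k \<le> n" "(parent ^^ k) u = r"
    using assms(3) by (auto simp: descendants_def)
  have "0 < u"
    using descendants_ge[OF assms(3)] assms(2) by simp
  then obtain l where l: "(parent ^^ (n - k)) l = u"
    using deep by blast
  then have "(parent ^^ n) l = r"
    using ancestor_split[of "n - k" n l] k by simp
  then show ?thesis
    using l diff_le_self unfolding leaves_def by blast
qed

text \<open>
  The distance from a vertex \<open>v\<close> up to \<open>r\<close> is determined by \<open>v\<close>, so \<open>v\<close> is reached from all leaves
  below it by the same power of \<open>parent\<close>. This power is monotone, hence the leaves that it sends to
  \<open>v\<close> are consecutive in the sorted list of leaves.
\<close>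

lemma path_decomposition_fan:
  assumes "mono parent" "\<And>v. 0 < v \<Longrightarrow> children v \<noteq> {}" "\<And>v. 0 < v \<Longrightarrow> finite (children v)" "0 < r"
  shows "path_decomposition (fan (descendants n r)) (map (leaf_bag n) (sorted_list_of_set (leaves n r)))"
    (is "path_decomposition (fan ?D) (map _ ?L)")
proof -
  have "leaves n r \<subseteq> ?D"
    by (auto simp: leaves_def descendants_def)
  then have fin: "finite (leaves n r)"
    using finite_descendants[OF assms(3,4)] finite_subset by blast
  then have set_L: "set ?L = leaves n r" and sorted_L: "sorted ?L"
    by simp_all
  have ex_leaf: "\<exists>l k. l \<in> set ?L \<and> k \<le> n \<and> (parent ^^ k) l = u" if "u \<in> ?D" for u
    using ex_leaf_below[OF assms(2,4) that] by (simp add: set_L)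
  have level: "(parent ^^ (n - k)) ((parent ^^ k) l) = r" if "l \<in> leaves n r" "k \<le> n" for l k
    using that ancestor_split[of k n l] by (simp add: leaves_def)
  have "leaf_bag n l \<subseteq> insert 0 ?D" if "l \<in> leaves n r" for l
  proof
    fix u assume "u \<in> leaf_bag n l"
    then consider "u = 0" | k where "k \<le> n" "u = (parent ^^ k) l"
      by (auto simp: leaf_bag_def)
    then show "u \<in> insert 0 ?D"
    proof cases
      case (2 k)
      then have "(parent ^^ (n - k)) u = r"
        using level that by simp
      then show ?thesis
        unfolding descendants_def using diff_le_self by blast
    qed simp
  qed
  then have subset: "\<forall>B\<in>set (map (leaf_bag n) ?L). B \<subseteq> pverts (fan ?D)"
    by (simp add: set_L pverts_fan)
  have contiguous: "\<exists>i j. i \<le> j \<and>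
      {k. k < length (map (leaf_bag n) ?L) \<and> v \<in> map (leaf_bag n) ?L ! k} = {i..j}"
    if "v \<in> pverts (fan ?D)" for v
  proof (rule nat_interval_if_convex)
    let ?I = "{k. k < length (map (leaf_bag n) ?L) \<and> v \<in> map (leaf_bag n) ?L ! k}"
    show "finite ?I"
      by simp
    have "r \<in> ?D"
      using rooted_descendants[OF assms(4)] by (simp add: rooted_def)
    then have "\<exists>l\<in>set ?L. v \<in> leaf_bag n l"
      using ex_leaf[of v] ex_leaf[of r] that by (auto simp: leaf_bag_def pverts_fan)
    then show "?I \<noteq> {}"
      by (auto simp: in_set_conv_nth)
    show "j \<in> ?I" if I: "i \<in> ?I" "k \<in> ?I" and ijk: "i \<le> j" "j \<le> k" for i j k
    proof (cases "v = 0")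
      case True
      then show ?thesis
        using I ijk by (simp add: leaf_bag_def)
    next
      case False
      then obtain p q where pq: "p \<le> n" "(parent ^^ p) (?L ! i) = v" "q \<le> n" "(parent ^^ q) (?L ! k) = v"
        using I ijk by (auto simp: leaf_bag_def)
      have "?L ! i \<in> leaves n r" "?L ! k \<in> leaves n r"
        using I ijk set_L nth_mem by auto
      then have "(parent ^^ (n - p)) v = r" "(parent ^^ (n - q)) v = r"
        using level[of "?L ! i" p] level[of "?L ! k" q] pq by simp_all
      then have "n - p = n - q"
        using ancestor_distance_unique assms(4) by blast
      then have "p = q"
        using pq by simp
      have "?L ! i \<le> ?L ! j" "?L ! j \<le> ?L ! k"
        using sorted_L I ijk by (auto intro: sorted_nth_mono)
      moreover have "mono (parent ^^ p)"
        using assms(1) by (induction p) (auto simp: mono_def)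
      ultimately have "(parent ^^ p) (?L ! j) = v"
        using pq \<open>p = q\<close> by (metis antisym monoD)
      then show ?thesis
        using pq I ijk by (auto simp: leaf_bag_def)
    qed
  qed
  have edges: "\<exists>B\<in>set (map (leaf_bag n) ?L). u \<in> B \<and> v \<in> B" if "(u, v) \<in> parcs (fan ?D)" for u v
  proof -
    have "\<exists>l\<in>set ?L. u \<in> leaf_bag n l \<and> parent u \<in> leaf_bag n l" if "u \<in> ?D" "parent u \<in> ?D" for u
    proof -
      obtain l k where l: "l \<in> set ?L" "k \<le> n" "(parent ^^ k) l = u"
        using ex_leaf[OF \<open>u \<in> ?D\<close>] by blast
      \<comment> \<open>The parent of \<open>u\<close> is one step further on the same path, unless \<open>u\<close> is the root.\<close>
      have "k \<noteq> n"
      proof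
        assume "k = n"
        then have "parent u < r"
          using l set_L parent_less[of r] assms(4) by (simp add: leaves_def)
        then show False
          using descendants_ge[OF \<open>parent u \<in> ?D\<close>] by simp
      qed
      then have "Suc k \<le> n" "(parent ^^ Suc k) l = parent u"
        using l by simp_all
      then have "u \<in> leaf_bag n l" "parent u \<in> leaf_bag n l"
        using l unfolding leaf_bag_def by (metis atMost_iff imageI insertCI)+
      then show ?thesis
        using l(1) by blast
    qed
    moreover have "\<exists>l\<in>set ?L. u \<in> leaf_bag n l" if "u \<in> ?D" for u
      using ex_leaf[OF that] by (auto simp: leaf_bag_def)
    moreover have "0 \<in> leaf_bag n l" for l
      by (simp add: leaf_bag_def)
    ultimately have "\<exists>l\<in>set ?L. u \<in> leaf_bag n l \<and> v \<in> leaf_bag n l"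
      using that unfolding arc_fan_iff by metis
    then show ?thesis
      by auto
  qed
  show ?thesis
    unfolding path_decomposition_def
    by (intro conjI ballI case_prodI2) (fact bspec[OF subset], fact contiguous, simp only: edges)
qed

lemma layered_pathwidth_fan_le:
  assumes "mono parent" "\<And>v. 0 < v \<Longrightarrow> children v \<noteq> {}" "\<And>v. 0 < v \<Longrightarrow> finite (children v)" "0 < r"
  shows "layered_pathwidth (fan (descendants n r)) \<le> n + 2"
proof (rule layered_pathwidth_le[OF path_decomposition_fan[OF assms]])
  fix B assume "B \<in> set (map (leaf_bag n) (sorted_list_of_set (leaves n r)))"
  then obtain l where "B = leaf_bag n l"
    by auto
  moreover have "card (leaf_bag n l) \<le> Suc (card ((\<lambda>k. (parent ^^ k) l) ` {..n}))"
    unfolding leaf_bag_def by (rule card_insert_le_m1) simp_all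
  moreover have "card ((\<lambda>k. (parent ^^ k) l) ` {..n}) \<le> Suc n"
    using card_image_le[of "{..n}"] by simp
  ultimately show "finite B \<and> card B \<le> n + 2"
    by (simp add: leaf_bag_def)
qed

end

section \<open>The complete ternary trees\<close>

text \<open>
  The root is 1. With this numbering the parent of the root is the apex 0, as the parent function of
  a \<open>rooted_forest\<close> requires.
\<close>

definition ternary_parent :: "nat \<Rightarrow> nat" where
  "ternary_parent v = (v + 1) div 3"

interpretation ternary: rooted_forest ternary_parent
  by unfold_locales (auto simp: ternary_parent_def)

lemma mono_ternary_parent: "mono ternary_parent"
  by (intro monoI) (auto simp: ternary_parent_def intro: div_le_mono)

lemma ternary_children:
  assumes "0 < v"
  shows "ternary.children v = {3 * v - 1, 3 * v, 3 * v + 1}"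
  unfolding ternary.children_def ternary_parent_def using assms by auto

lemma card_ternary_children: "0 < v \<Longrightarrow> card (ternary.children v) = 3"
  by (auto simp: ternary_children card_insert_if)

theorem theorem19:
  shows "\<exists>G :: nat \<Rightarrow> nat pair_pre_digraph.
    (\<forall>h. pair_graph (G h) \<and> series_parallel (G h) \<and> tree_apex_graph (G h) \<and>
         track_number (G h) \<le> 4) \<and>
    (\<lambda>h. real (layered_pathwidth (G h))) \<in> \<Theta>(\<lambda>h. real h)"
proof (intro exI conjI allI)
  define D where "D h = ternary.descendants h 1" for h
  let ?G = "\<lambda>h. ternary.fan (D h)"
  have fin: "finite (ternary.children v)" if "0 < v" for v
    using that by (simp add: ternary_children)
  have nonempty: "ternary.children v \<noteq> {}" if "0 < v" for v
    using that by (simp add: ternary_children)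
  have D: "finite (D h)" "ternary.rooted (D h) 1" "0 \<notin> D h" for h
    using ternary.finite_descendants[OF fin] ternary.rooted_descendants[of 1 h]
    by (auto simp: D_def ternary.rooted_def)
  show "pair_graph (?G h)" "tree_apex_graph (?G h)" "track_number (?G h) \<le> 4" for h
    using ternary.pair_graph_fan[OF D(1,3)] ternary.tree_apex_graph_fan[OF D(1,2)]
      ternary.track_number_fan[OF D(1,3) mono_ternary_parent] by simp_all
  show "series_parallel (?G h)" for h
    unfolding series_parallel_def D_def
    by (rule exI[of _ 1], rule exI[of _ 0], rule ternary.two_terminal_sp_fan) (simp_all add: fin)
  have lower: "h \<le> 3 * layered_pathwidth (?G h)" for h
    unfolding D_def by (rule ternary.layered_pathwidth_fan_ge) (simp_all add: card_ternary_children)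
  have upper: "layered_pathwidth (?G h) \<le> h + 2" for h
    unfolding D_def
    by (rule ternary.layered_pathwidth_fan_le[OF mono_ternary_parent nonempty fin]) simp_all
  show "(\<lambda>h. real (layered_pathwidth (?G h))) \<in> \<Theta>(\<lambda>h. real h)"
  proof (rule bigthetaI)
    have "real (layered_pathwidth (?G h)) \<le> 3 * real h" if "1 \<le> h" for h
      using upper[of h] that by linarith
    then show "(\<lambda>h. real (layered_pathwidth (?G h))) \<in> O(\<lambda>h. real h)"
      by (intro bigoI[of _ 3]) (auto intro!: eventually_sequentiallyI[of 1])
    have "real h \<le> 3 * real (layered_pathwidth (?G h))" for h
      using lower[of h] by linarith
    then show "(\<lambda>h. real (layered_pathwidth (?G h))) \<in> \<Omega>(\<lambda>h. real h)"
      by (intro landau_omega.bigI[of "1/3"]) (auto simp: field_simps)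
  qed
qed

end
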